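(* Let $a>0$ and $n\in\mathbb{N}$. For $\xi\in\mathbb{R}^n$ put $h_{a,\xi}(x)=e^{-a|x-\xi|^2}$, $x\in\mathbb{R}^n$. Then for all $\xi,\eta\in\mathbb{R}^n$ $$e^{-\frac a2|\xi-\eta|^2}=\Bigl(\frac{2a}{\pi}\Bigr)^{n/2}\langle h_{a,\xi},h_{a,\eta}\rangle_{L^2(\mathbb{R}^n)} .$$ Consequently, for every sequence $\{x_j\}_{j\in\mathbb{N}}\subset\mathbb{R}^n$, $$\Bigl\|\exp\Bigl(-\frac a2|x_i-x_j|^2\Bigr)\Bigr\|_{i,j\in\mathbb{N}}=\Bigl(\frac{2a}{\pi}\Bigr)^{n/2}Gr(\{f_j\},L^2(\mathbb{R}^n)),\qquad f_j(x)=e^{-a|x-x_j|^2}.$$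
   Context: $|\cdot|$ is the Euclidean norm. $Gr(\{f_j\},\mathcal{H})=\|\langle f_i,f_j\rangle_{\mathcal{H}}\|_{i,j\in\mathbb{N}}$ denotes the Gram matrix of a sequence $\{f_j\}$ in a Hilbert space $\mathcal{H}$. *)

theory Defs
  imports "HOL-Analysis.Analysis"
begin

text \<open>
  The complex Hilbert space \<open>L\<^sup>2(M)\<close> is handled through representatives: its elements are
  measurable, square-integrable functions, not identified up to null sets. The inner product
  does not depend on the representatives. It is linear in the first argument. Because the
  Bochner integral of a non-integrable function is 0, \<open>L2_inner M f g\<close> is meaningful only for
  \<open>f, g \<in> L2_space M\<close>.
\<close>

definition L2_space :: "'a measure \<Rightarrow> ('a \<Rightarrow> complex) set" where
  "L2_space M = {f \<in> borel_measurable M. integrable M (\<lambda>x. (cmod (f x))\<^sup>2)}"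

definition L2_inner :: "'a measure \<Rightarrow> ('a \<Rightarrow> complex) \<Rightarrow> ('a \<Rightarrow> complex) \<Rightarrow> complex" where
  "L2_inner M f g = (LINT x|M. f x * cnj (g x))"

text \<open>
  The infinite matrix \<open>(\<langle>f\<^sub>i, f\<^sub>j\<rangle>)\<close> is a function of its two indices; the Hilbert space enters
  through its inner product \<open>ip\<close>.
\<close>

definition gram_matrix :: "('h \<Rightarrow> 'h \<Rightarrow> complex) \<Rightarrow> (nat \<Rightarrow> 'h) \<Rightarrow> nat \<Rightarrow> nat \<Rightarrow> complex" where
  "gram_matrix ip f = (\<lambda>i j. ip (f i) (f j))"

definition gaussian :: "real \<Rightarrow> real ^ 'n \<Rightarrow> real ^ 'n \<Rightarrow> complex" where
  "gaussian a \<xi> = (\<lambda>x. complex_of_real (exp (- (a * (norm (x - \<xi>))\<^sup>2))))"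

end

theory Submission
  imports Defs "HOL-Probability.Distributions"
begin

text \<open>
  With \<open>m\<close> the midpoint of \<open>\<xi>\<close> and \<open>\<eta>\<close>, the parallelogram law gives
  \<open>\<bar>x - \<xi>\<bar>\<^sup>2 + \<bar>x - \<eta>\<bar>\<^sup>2 = 2\<bar>x - m\<bar>\<^sup>2 + \<bar>\<xi> - \<eta>\<bar>\<^sup>2/2\<close>. So the product of the two Gaussians is a constant
  multiple of a Gaussian of exponent \<open>2a\<close> centred at \<open>m\<close>, whose integral \<open>(\<pi>/(2a))\<^sup>n\<^sup>/\<^sup>2\<close> is a product
  of one-dimensional ones.
\<close>

text \<open>Up to the factor \<open>sqrt (pi / b)\<close>, the integrand is a normal density with
  mean \<open>c\<close>, whose total mass is 1.\<close>

lemma nn_integral_gaussian_real: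
  fixes b c :: real
  assumes "b > 0"
  shows "(\<integral>\<^sup>+x. ennreal (exp (- (b * (x - c)\<^sup>2))) \<partial>lborel) = ennreal (sqrt (pi / b))"
proof -
  \<comment> \<open>This standard deviation turns the density's exponent -(x - c)^2 / (2 s^2) into
    -b (x - c)^2.\<close>
  define s where "s = 1 / sqrt (2 * b)"
  have s: "s > 0" "s\<^sup>2 = 1 / (2 * b)"
    using assms by (auto simp: s_def power_divide)
  have eq: "exp (- (b * (x - c)\<^sup>2)) = sqrt (pi / b) * normal_density c s x" for x
    using assms by (simp add: normal_density_def s)
  have "(\<integral>\<^sup>+x. ennreal (normal_density c s x) \<partial>lborel) = 1"
    using s by (simp add: nn_integral_eq_integral)
  then show ?thesis
    using assms by (simp add: eq ennreal_mult nn_integral_cmult)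
qed

text \<open>The integrand factors over the coordinates, so Tonelli reduces it to dimension one.
  Computing the nonnegative integral first yields integrability along with the value.\<close>

lemma has_bochner_integral_gaussian:
  fixes c :: "'a :: euclidean_space"
  assumes "b > 0"
  shows "has_bochner_integral lborel (\<lambda>x. exp (- (b * (norm (x - c))\<^sup>2)))
           ((pi / b) powr (real DIM('a) / 2))"
proof (rule has_bochner_integral_nn_integral)
  have norm: "ennreal (exp (- (b * (norm (x - c))\<^sup>2))) =
      (\<Prod>i\<in>Basis. ennreal (exp (- (b * (x \<bullet> i - c \<bullet> i)\<^sup>2))))" for x
  proof -
    have "(norm (x - c))\<^sup>2 = (\<Sum>i\<in>Basis. (x \<bullet> i - c \<bullet> i)\<^sup>2)"
      unfolding power2_norm_eq_inner euclidean_inner[of "x - c" "x - c"]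
      by (simp add: inner_diff_left power2_eq_square)
    then show ?thesis
      by (simp add: prod_ennreal exp_sum sum_distrib_left flip: sum_negf)
  qed
  have "(\<integral>\<^sup>+x. ennreal (exp (- (b * (norm (x - c))\<^sup>2))) \<partial>lborel) =
      (\<Prod>i\<in>(Basis :: 'a set). ennreal (sqrt (pi / b)))"
    unfolding norm
    by (subst nn_integral_lborel_prod) (simp_all add: nn_integral_gaussian_real[OF assms])
  also have "\<dots> = ennreal ((pi / b) powr (real DIM('a) / 2))"
  proof -
    have "sqrt (pi / b) ^ DIM('a) = ((pi / b) powr (1 / 2)) powr real DIM('a)"
      using assms by (subst powr_realpow) (simp_all add: powr_half_sqrt)
    also have "\<dots> = (pi / b) powr (real DIM('a) / 2)"
      by (simp add: powr_powr)
    finally show ?thesis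
      using assms by (simp add: ennreal_power)
  qed
  finally show "(\<integral>\<^sup>+x. ennreal (exp (- (b * (norm (x - c))\<^sup>2))) \<partial>lborel) =
      ennreal ((pi / b) powr (real DIM('a) / 2))" .
qed auto

text \<open>\<open>lebesgue\<close> is the completion of \<open>lborel\<close>, and completion does
  not change the integral of a Borel function.\<close>

lemma has_bochner_integral_lebesgue_gaussian:
  fixes c :: "'a :: euclidean_space"
  assumes "b > 0"
  shows "has_bochner_integral lebesgue (\<lambda>x. exp (- (b * (norm (x - c))\<^sup>2)))
           ((pi / b) powr (real DIM('a) / 2))"
  using has_bochner_integral_gaussian[OF assms, of c]
  by (simp add: has_bochner_integral_iff integrable_completion integral_completion)

text \<open>This is the parallelogram law for x - y and x - z: their sum is twice the vector from
  the midpoint to x, their difference is z - y.\<close>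

lemma norm_diff_sq_add_norm_diff_sq:
  fixes x y z :: "'a :: real_inner"
  shows "(norm (x - y))\<^sup>2 + (norm (x - z))\<^sup>2 =
    2 * (norm (x - (y + z) /\<^sub>R 2))\<^sup>2 + (norm (y - z))\<^sup>2 / 2"
  by (simp add: power2_norm_eq_inner inner_diff_left inner_diff_right inner_add_left
      inner_add_right inner_commute[of y x] inner_commute[of z x] inner_commute[of z y] field_simps)

text \<open>Squaring doubles the exponent, which leaves an integrable Gaussian. Membership is what
  makes the inner products below meaningful.\<close>

lemma gaussian_in_L2_space:
  assumes "a > 0"
  shows "gaussian a \<xi> \<in> L2_space lebesgue"
proof -
  have "(\<lambda>x. (cmod (gaussian a \<xi> x))\<^sup>2) = (\<lambda>x. exp (- (2 * a * (norm (x - \<xi>))\<^sup>2)))"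
    by (simp add: gaussian_def power2_eq_square mult.assoc flip: exp_add)
  moreover have "integrable lebesgue (\<lambda>x. exp (- (2 * a * (norm (x - \<xi>))\<^sup>2)))"
    using has_bochner_integral_lebesgue_gaussian[of "2 * a" \<xi>] assms
    by (simp add: has_bochner_integral_iff)
  moreover have "gaussian a \<xi> \<in> borel_measurable lebesgue"
    unfolding gaussian_def by (rule measurable_completion) simp
  ultimately show ?thesis
    by (simp add: L2_space_def)
qed

lemma L2_inner_gaussian:
  fixes \<xi> \<eta> :: "real ^ 'n"
  assumes "a > 0"
  shows "L2_inner lebesgue (gaussian a \<xi>) (gaussian a \<eta>) =
    complex_of_real (exp (- (a / 2 * (norm (\<xi> - \<eta>))\<^sup>2)) * (pi / (2 * a)) powr (real CARD('n) / 2))"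
proof -
  define m where "m = (\<xi> + \<eta>) /\<^sub>R 2"
  have "- (a * (norm (x - \<xi>))\<^sup>2) - a * (norm (x - \<eta>))\<^sup>2 =
      - (a / 2 * (norm (\<xi> - \<eta>))\<^sup>2) - 2 * a * (norm (x - m))\<^sup>2" for x
    using arg_cong[OF norm_diff_sq_add_norm_diff_sq[of x \<xi> \<eta>], of "(*) (- a)"]
    by (simp add: m_def algebra_simps)
  then have "gaussian a \<xi> x * cnj (gaussian a \<eta> x) =
      complex_of_real (exp (- (a / 2 * (norm (\<xi> - \<eta>))\<^sup>2)) * exp (- (2 * a * (norm (x - m))\<^sup>2)))" for x
    by (simp add: gaussian_def flip: of_real_mult exp_add)
  moreover have "has_bochner_integral lebesgue (\<lambda>x. exp (- (2 * a * (norm (x - m))\<^sup>2)))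
      ((pi / (2 * a)) powr (real CARD('n) / 2))"
    using has_bochner_integral_lebesgue_gaussian[of "2 * a" m] assms by simp
  ultimately show ?thesis
    \<comment> \<open>With \<open>of_real_mult\<close> disabled, the integrand remains the complex
      image of a single real function, so the real integral carries over.\<close>
    by (simp add: L2_inner_def has_bochner_integral_iff del: of_real_mult)
qed

theorem proposition4p12:
  fixes a :: real
  assumes "a > 0"
  shows "(\<forall>\<xi> :: real ^ 'n. gaussian a \<xi> \<in> L2_space lebesgue) \<and>
    (\<forall>\<xi> \<eta> :: real ^ 'n.
      complex_of_real (exp (- (a / 2 * (norm (\<xi> - \<eta>))\<^sup>2))) =
      complex_of_real ((2 * a / pi) powr (real CARD('n) / 2)) *
        L2_inner lebesgue (gaussian a \<xi>) (gaussian a \<eta>)) \<and>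
    (\<forall>x :: nat \<Rightarrow> real ^ 'n.
      (\<lambda>i j. complex_of_real (exp (- (a / 2 * (norm (x i - x j))\<^sup>2)))) =
      (\<lambda>i j. complex_of_real ((2 * a / pi) powr (real CARD('n) / 2)) *
        gram_matrix (L2_inner lebesgue) (\<lambda>j. gaussian a (x j)) i j))"
proof -
  \<comment> \<open>The bases 2a/pi and pi/(2a) are reciprocal, so their equal powers cancel;
    \<open>e\<close> stands for the exponential factor.\<close>
  have "(2 * a / pi) powr (real CARD('n) / 2) * (e * (pi / (2 * a)) powr (real CARD('n) / 2)) = e" for e
    using assms by (simp add: mult.left_commute[of _ e] flip: powr_mult)
  then have "complex_of_real (exp (- (a / 2 * (norm (\<xi> - \<eta>))\<^sup>2))) =
      complex_of_real ((2 * a / pi) powr (real CARD('n) / 2)) *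
        L2_inner lebesgue (gaussian a \<xi>) (gaussian a \<eta>)" for \<xi> \<eta> :: "real ^ 'n"
    by (simp only: L2_inner_gaussian[OF assms] flip: of_real_mult)
  then show ?thesis
    by (simp add: gaussian_in_L2_space[OF assms] gram_matrix_def)
qed

end
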